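(* For every fixed integer $k\ge 1$, the limit $\lim_{n\to\infty} a_{n,k}$ exists, where $a_{n,k}$ is the proportion of minimally overlapping patterns in $\mathcal{F}_{n,k}$.
   Context: For $n,k\ge 1$, $\mathcal{F}_{n,k}$ is the set of column-strict arrays with $n$ columns and $k$ rows: fillings of a rectangular array with $n$ columns and $k$ rows by the numbers $1,2,\ldots,kn$, each used exactly once, such that the entries increase from bottom to top in each column. Columns are labeled from left to right. If $F$ is a filling of a rectangle with $n$ columns and $k$ rows by distinct positive integers increasing from bottom to top in each column, then $\mathrm{red}(F)\in\mathcal{F}_{n,k}$ is obtained by replacing the $i$th smallest entry of $F$ by $i$, for all $i$. For $F\in\mathcal{F}_{n,k}$ and $1\le c_1<\cdots<c_j\le n$, $F[c_1,\ldots,c_j]$ is the filling with $j$ columns whose $a$th column is column $c_a$ of $F$. For $P\in\mathcal{F}_{j,k}$ and $F\in\mathcal{F}_{n,k}$ with $j\le n$, there is a $P$-match in $F$ starting at position $i$ if $\mathrm{red}(F[i,i+1,\ldots,i+j-1])=P$; $P\text{-mch}(F)$ is the number of $P$-matches in $F$. The pattern $P\in\mathcal{F}_{j,k}$ is minimally overlapping if the smallest $i$ for which there exists $F\in\mathcal{F}_{i,k}$ with $P\text{-mch}(F)=2$ is $i=2j-1$. $M_{n,k}$ is the number of minimally overlapping $P\in\mathcal{F}_{n,k}$, and $a_{n,k}=M_{n,k}/|\mathcal{F}_{n,k}|$. *)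

theory Defs
  imports Complex_Main
begin

text \<open>An array is the list of its columns from left to right; each column is the list of
  its entries from bottom to top. Column labels and positions are counted from 1.\<close>

type_synonym filling = "nat list list"

definition arrays :: "nat \<Rightarrow> nat \<Rightarrow> filling set" where
  "arrays n k = {F. length F = n \<and>
     (\<forall>c\<in>set F. length c = k \<and> sorted_wrt (<) c) \<and>
     distinct (concat F) \<and> set (concat F) = {1..k * n}}"

text \<open>The \<open>i\<close>th smallest entry is the one with exactly \<open>i\<close> entries less than or equal to it.\<close>

definition red :: "filling \<Rightarrow> filling" where
  "red F = map (map (\<lambda>x. card {y \<in> set (concat F). y \<le> x})) F"

definition select_columns :: "filling \<Rightarrow> nat list \<Rightarrow> filling" where
  "select_columns F cs = map (\<lambda>c. F ! (c - 1)) cs"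

definition match_at :: "filling \<Rightarrow> filling \<Rightarrow> nat \<Rightarrow> bool" where
  "match_at P F i \<longleftrightarrow> 1 \<le> i \<and> i + length P \<le> length F + 1 \<and>
     red (select_columns F [i..<i + length P]) = P"

definition mch :: "filling \<Rightarrow> filling \<Rightarrow> nat" where
  "mch P F = card {i. match_at P F i}"

definition two_match_sizes :: "nat \<Rightarrow> filling \<Rightarrow> nat set" where
  "two_match_sizes k P = {i. 1 \<le> i \<and> (\<exists>F\<in>arrays i k. mch P F = 2)}"

text \<open>Being the smallest element is spelled out, since \<open>LEAST\<close> would be an
  unspecified number if no array had exactly two matches.\<close>

definition minimally_overlapping :: "nat \<Rightarrow> nat \<Rightarrow> filling \<Rightarrow> bool" where
  "minimally_overlapping j k P \<longleftrightarrow> P \<in> arrays j k \<and>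
     2 * j - 1 \<in> two_match_sizes k P \<and> (\<forall>i\<in>two_match_sizes k P. 2 * j - 1 \<le> i)"

definition num_minimally_overlapping :: "nat \<Rightarrow> nat \<Rightarrow> nat" where
  "num_minimally_overlapping n k = card {P. minimally_overlapping n k P}"

definition proportion :: "nat \<Rightarrow> nat \<Rightarrow> real" where
  "proportion n k = real (num_minimally_overlapping n k) / real (card (arrays n k))"

lemma finite_arrays: "finite (arrays n k)"
proof (rule finite_subset)
  let ?C = "{c :: nat list. set c \<subseteq> {1..k * n} \<and> length c = k}"
  show "arrays n k \<subseteq> {F. set F \<subseteq> ?C \<and> length F = n}"
    unfolding arrays_def by auto
  have "finite ?C" by (rule finite_lists_length_eq) simp
  then show "finite {F. set F \<subseteq> ?C \<and> length F = n}" by (rule finite_lists_length_eq)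
qed

end

(* Call i a border of P if the first i and the last i columns of P have the same reduction. Gluing
   two copies of P along a border shows that P is minimally overlapping iff it has no border i with
   2 <= i < n. The shortest border >= 2 satisfies 2 i <= n + 1. Deleting the middle column keeps
   all borders with 2 i <= n and has fibres of constant size, so the proportion of arrays without
   borders 2 <= i <= n / 2 is decreasing in n. The one remaining border size i = (n + 1) / 2 has
   probability at most 1 / (n div 2). *)

theory Submission
  imports Defs
begin

section \<open>Ranks and reduction\<close>

abbreviation entries :: "filling \<Rightarrow> nat set" where
  "entries F \<equiv> set (concat F)"

text \<open>Used also for \<open>x\<close> outside \<open>S\<close>; it then counts the elements of
  \<open>S\<close> below \<open>x\<close>, which is how non-border entries are placed when two
  copies are glued.\<close>

definition rank :: "nat set \<Rightarrow> nat \<Rightarrow> nat" where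
  "rank S x = card {y \<in> S. y \<le> x}"

lemma red_eq_map_rank: "red F = map (map (rank (entries F))) F"
  by (simp add: red_def rank_def)

lemma rank_less:
  assumes "finite S" "x < y" "y \<in> S"
  shows "rank S x < rank S y"
proof -
  have "y \<in> {z \<in> S. z \<le> y} - {z \<in> S. z \<le> x}" using assms by auto
  moreover have "{z \<in> S. z \<le> x} \<subseteq> {z \<in> S. z \<le> y}" using assms by auto
  ultimately have "{z \<in> S. z \<le> x} \<subset> {z \<in> S. z \<le> y}" by blast
  then show ?thesis unfolding rank_def by (intro psubset_card_mono) (use assms in auto)
qed

lemma rank_mono:
  assumes "finite S" "x \<le> y"
  shows "rank S x \<le> rank S y"
  unfolding rank_def by (intro card_mono) (use assms in auto)

lemma strict_mono_on_rank: "finite S \<Longrightarrow> strict_mono_on S (rank S)"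
  by (simp add: strict_mono_on_def rank_less)

lemma rank_image:
  assumes "finite S"
  shows "rank S ` S = {1..card S}"
proof (rule card_subset_eq)
  have "1 \<le> rank S x \<and> rank S x \<le> card S" if "x \<in> S" for x
  proof -
    have "{y \<in> S. y \<le> x} \<noteq> {}" using that by auto
    then have "0 < rank S x" unfolding rank_def using assms by (simp add: card_gt_0_iff)
    moreover have "rank S x \<le> card S"
      unfolding rank_def by (intro card_mono) (use assms in auto)
    ultimately show ?thesis by simp
  qed
  then show "rank S ` S \<subseteq> {1..card S}" by auto
  show "card (rank S ` S) = card {1..card S}"
    using strict_mono_on_imp_inj_on[OF strict_mono_on_rank[OF assms]] by (simp add: card_image)
qed simp

lemma rank_strict_mono_on_image:
  assumes "strict_mono_on S f" "x \<in> S"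
  shows "rank (f ` S) (f x) = rank S x"
proof -
  have "{y \<in> f ` S. y \<le> f x} = f ` {y \<in> S. y \<le> x}"
    using assms by (auto simp: strict_mono_on_leD) (metis imageI leI mem_Collect_eq leD strict_mono_onD)
  moreover have "inj_on f {y \<in> S. y \<le> x}"
    by (rule inj_on_subset[OF strict_mono_on_imp_inj_on[OF assms(1)]]) auto
  ultimately show ?thesis by (simp add: rank_def card_image)
qed

lemma entries_map: "entries (map (map f) F) = f ` entries F"
  by auto

lemma map_map_cong: "(\<And>x. x \<in> entries F \<Longrightarrow> f x = g x) \<Longrightarrow> map (map f) F = map (map g) F"
  by auto

text \<open>Reduction sees only the relative order of the entries, so any order-preserving
  relabelling is invisible to it. Every later comparison of reduced fillings rests on this.\<close>

lemma red_map:
  assumes "strict_mono_on (entries F) f"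
  shows "red (map (map f) F) = red F"
proof -
  have "red (map (map f) F) = map (map (\<lambda>x. rank (f ` entries F) (f x))) F"
    unfolding red_eq_map_rank entries_map by (simp add: comp_def)
  also have "\<dots> = map (map (rank (entries F))) F"
    by (rule map_map_cong) (rule rank_strict_mono_on_image[OF assms])
  finally show ?thesis by (simp add: red_eq_map_rank)
qed

lemma strict_mono_on_rank_subset:
  "finite S \<Longrightarrow> T \<subseteq> S \<Longrightarrow> strict_mono_on T (rank S)"
  by (meson strict_mono_on_rank monotone_on_subset)

lemma length_red [simp]: "length (red F) = length F"
  by (simp add: red_def)

text \<open>Ranks taken in all of \<open>F\<close> are strictly increasing on the entries of any
  window, so \<open>red_map\<close> applies to the window. Hence patterns of windows can be read off
  from \<open>red F\<close>.\<close>

lemma red_take_drop_red: "red (take l (drop a (red F))) = red (take l (drop a F))"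
proof -
  have "entries (take l (drop a F)) \<subseteq> entries F"
    by (auto dest!: in_set_takeD in_set_dropD)
  then have "red (map (map (rank (entries F))) (take l (drop a F))) = red (take l (drop a F))"
    by (intro red_map strict_mono_on_rank_subset) auto
  then show ?thesis by (simp add: red_eq_map_rank[of F] take_map drop_map)
qed

lemma red_take_red: "red (take l (red F)) = red (take l F)"
  using red_take_drop_red[of l 0] by simp

lemma red_drop_red: "red (drop a (red F)) = red (drop a F)"
  using red_take_drop_red[of "length F" a F] by simp

lemma red_take_drop_cong:
  assumes "red F = red G"
  shows "red (take l (drop a F)) = red (take l (drop a G))"
  by (metis assms red_take_drop_red)

section \<open>Column-strict fillings with arbitrary entries\<close>

text \<open>The conditions of \<open>arrays\<close> without the prescribed entry set; unlike
  \<open>arrays\<close>, they survive taking or dropping columns and increasing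
  relabellings.\<close>

definition column_strict :: "nat \<Rightarrow> filling \<Rightarrow> bool" where
  "column_strict k F \<longleftrightarrow> (\<forall>c\<in>set F. length c = k \<and> sorted_wrt (<) c) \<and> distinct (concat F)"

lemma arrays_iff:
  "F \<in> arrays n k \<longleftrightarrow> length F = n \<and> column_strict k F \<and> entries F = {1..k * n}"
  by (auto simp: arrays_def column_strict_def)

lemma column_strict_map:
  assumes "column_strict k F" "strict_mono_on (entries F) f"
  shows "column_strict k (map (map f) F)"
proof -
  have "sorted_wrt (<) (map f c)" if "c \<in> set F" for c
    unfolding sorted_wrt_map
    by (rule sorted_wrt_mono_rel[of _ "(<)"])
       (use assms that in \<open>auto simp: column_strict_def intro!: strict_mono_onD[OF assms(2)]\<close>)
  moreover have "distinct (concat (map (map f) F))"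
    using assms strict_mono_on_imp_inj_on[OF assms(2)]
    by (simp add: map_concat[symmetric] distinct_map column_strict_def)
  ultimately show ?thesis using assms by (auto simp: column_strict_def)
qed

lemma card_entries:
  assumes "column_strict k F"
  shows "card (entries F) = k * length F"
proof -
  have "card (entries F) = length (concat F)"
    using assms by (simp only: column_strict_def distinct_card)
  also have "\<dots> = sum_list (map (\<lambda>_. k) F)"
    unfolding length_concat by (intro arg_cong[where f = sum_list] map_cong)
       (use assms in \<open>auto simp: column_strict_def\<close>)
  also have "\<dots> = k * length F" by (simp add: sum_list_triv)
  finally show ?thesis .
qed

lemma red_in_arrays:
  assumes "column_strict k F"
  shows "red F \<in> arrays (length F) k"
proof -
  have "column_strict k (red F)"
    unfolding red_eq_map_rank by (intro column_strict_map assms strict_mono_on_rank) simp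
  moreover have "entries (red F) = {1..k * length F}"
    unfolding red_eq_map_rank entries_map card_entries[OF assms, symmetric]
    by (rule rank_image) simp
  ultimately show ?thesis by (simp add: arrays_iff)
qed

lemma red_arrays:
  assumes "F \<in> arrays n k"
  shows "red F = F"
proof -
  have "rank {1..k * n} x = x" if "x \<in> {1..k * n}" for x
  proof -
    have "{y \<in> {1..k * n}. y \<le> x} = {1..x}" using that by auto
    then show ?thesis by (simp add: rank_def)
  qed
  then have "map (map (rank (entries F))) F = map (map id) F"
    using assms by (intro map_map_cong) (auto simp only: arrays_iff id_apply)
  then show ?thesis by (simp add: red_eq_map_rank)
qed

lemma column_strict_take: "column_strict k F \<Longrightarrow> column_strict k (take i F)"
  unfolding column_strict_def
  by (metis append_take_drop_id concat_append distinct_append in_set_takeD)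

lemma column_strict_drop: "column_strict k F \<Longrightarrow> column_strict k (drop i F)"
  unfolding column_strict_def
  by (metis append_take_drop_id concat_append distinct_append in_set_dropD)

lemma arrays_1_unique:
  assumes "F \<in> arrays 1 k" "G \<in> arrays 1 k"
  shows "F = G"
proof -
  obtain c where c: "F = [c]" using assms(1) by (auto simp: arrays_iff length_Suc_conv)
  obtain d where d: "G = [d]" using assms(2) by (auto simp: arrays_iff length_Suc_conv)
  have "c = d"
    using assms c d strict_sorted_equal[of c d] by (simp add: arrays_iff column_strict_def)
  then show ?thesis using c d by simp
qed

section \<open>Borders of patterns\<close>

text \<open>The analogue, for order patterns, of a border of a word; \<open>length P - i\<close>
  plays the role of a period.\<close>

definition border :: "filling \<Rightarrow> nat \<Rightarrow> bool" where
  "border P i \<longleftrightarrow> red (take i P) = red (drop (length P - i) P)"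

text \<open>All single columns have the same reduction. This unavoidable border is the reason why
  \<open>2 * n - 1\<close> columns are attainable and why only sizes from 2 on matter.\<close>

lemma border_1:
  assumes "column_strict k P" "1 \<le> length P"
  shows "border P 1"
proof -
  have "red (take 1 P) \<in> arrays 1 k"
    using red_in_arrays[OF column_strict_take[OF assms(1), of 1]] assms(2) by (simp add: min_absorb2)
  moreover have "red (drop (length P - 1) P) \<in> arrays 1 k"
    using red_in_arrays[OF column_strict_drop[OF assms(1), of "length P - 1"]] assms(2) by simp
  ultimately show ?thesis unfolding border_def by (rule arrays_1_unique)
qed

text \<open>Up to reduction, \<open>d = length P - i\<close> is a period of \<open>P\<close>.
  Applying the shift twice gives the period \<open>2 * d\<close>, that is, the border size
  \<open>length P - 2 * d = 2 * i - length P\<close>.\<close>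

lemma border_shrink:
  assumes "border P i" "i \<le> length P" "length P \<le> 2 * i"
  shows "border P (2 * i - length P)"
proof -
  define d where "d = length P - i"
  define l where "l = i - d"
  have l: "l = 2 * i - length P" "l + d = i" "d + i = length P"
    using assms by (auto simp: d_def l_def)
  have b: "red (take i P) = red (drop d P)" using assms(1) by (simp add: border_def d_def)
  have "red (take l P) = red (take l (drop d P))"
    using red_take_drop_cong[OF b, of l 0] l by (simp add: min_def)
  also have "\<dots> = red (take l (drop d (take i P)))"
    using l by (simp add: drop_take min_def)
  also have "\<dots> = red (take l (drop d (drop d P)))"
    by (rule red_take_drop_cong[OF b])
  also have "take l (drop d (drop d P)) = drop (length P - l) P"
  proof -
    have "d + d = length P - l" "l = length P - (d + d)" using l assms by auto
    then show ?thesis by simp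
  qed
  finally show ?thesis using l by (simp add: border_def)
qed

text \<open>If \<open>2 * i > length P + 1\<close>, then \<open>border_shrink\<close> gives the size
  \<open>2 * i - length P\<close>, which is still at least 2 and smaller than \<open>i\<close>;
  descent ends in the required range.\<close>

lemma ex_short_border:
  assumes "border P i" "2 \<le> i" "i < length P"
  shows "\<exists>j. 2 \<le> j \<and> 2 * j \<le> length P + 1 \<and> border P j"
  using assms
proof (induction i rule: less_induct)
  case (less i)
  show ?case
  proof (cases "2 * i \<le> length P + 1")
    case True
    then show ?thesis using less.prems by blast
  next
    case False
    then show ?thesis
      using less.IH[of "2 * i - length P"] border_shrink[of P i] less.prems by auto
  qed
qed

section \<open>Matches, overlaps and minimally overlapping patterns\<close>

lemma select_columns_interval:
  assumes "1 \<le> i" "i + l \<le> length F + 1"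
  shows "select_columns F [i..<i + l] = take l (drop (i - 1) F)"
  by (rule nth_equalityI) (use assms in \<open>auto simp: select_columns_def\<close>)

lemma match_at_iff:
  "match_at P F i \<longleftrightarrow> 1 \<le> i \<and> i + length P \<le> length F + 1 \<and>
     red (take (length P) (drop (i - 1) F)) = P"
  by (auto simp: match_at_def select_columns_interval)

text \<open>The columns shared by the two matches are the last ones of the first copy and the first
  ones of the second copy.\<close>

lemma border_if_matches:
  assumes "match_at P F p" "match_at P F q" "p < q" "q - p < length P"
  shows "border P (length P - (q - p))"
proof -
  define n where "n = length P"
  define d where "d = q - p"
  have P: "red (take n (drop (p - 1) F)) = P" "red (take n (drop (q - 1) F)) = P" "1 \<le> p"
    using assms by (auto simp: match_at_iff n_def)
  have "red (take (n - d) P) = red (take (n - d) (take n (drop (q - 1) F)))"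
    by (metis P(2) red_take_red)
  also have "\<dots> = red (drop d (take n (drop (p - 1) F)))"
    using assms(3) P(3) by (simp add: drop_take d_def)
  also have "\<dots> = red (drop d P)" by (metis P(1) red_drop_red)
  finally show ?thesis using assms(4) by (simp add: border_def n_def d_def)
qed

text \<open>Two copies of \<open>P\<close> are glued along the border: in both copies an entry is sent to a block
  determined by the number of border entries up to it, and inside a block the border entry comes
  first, then the other entries of the left copy, then those of the right copy.\<close>

lemma ex_overlap:
  assumes "P \<in> arrays n k" "border P i" "i \<le> n"
  shows "\<exists>F\<in>arrays (2 * n - i) k. red (take n F) = P \<and> red (drop (n - i) F) = P"
proof -
  have P: "length P = n" "column_strict k P" "entries P = {1..k * n}"
    using assms(1) by (auto simp only: arrays_iff)
  define M where "M = k * n + 1"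
  define C where "C = entries (drop (n - i) P)"
  define D where "D = entries (take i P)"
  \<comment> \<open>Blocks have length \<open>3 * M\<close>, where \<open>M\<close> exceeds every
    entry. Offsets inside a block are 0 for border entries, below \<open>M\<close> for the left copy
    and between \<open>M\<close> and \<open>2 * M\<close> for the right copy.\<close>
  define f where "f = (\<lambda>x. 3 * M * rank C x + (if x \<in> C then 0 else x))"
  define g where "g = (\<lambda>x. 3 * M * rank D x + (if x \<in> D then 0 else M + x))"
  have fin: "finite C" "finite D" by (auto simp: C_def D_def)
  have ltM: "x < M" "0 < x" if "x \<in> entries P" for x
    using that unfolding P(3) M_def by auto
  \<comment> \<open>Equal ranks force \<open>y\<close> outside \<open>S\<close>, and the offsets
    decide; otherwise the jump by at least one block outweighs any offset.\<close>
  have mono: "strict_mono_on (entries P) (\<lambda>x. 3 * M * rank S x + (if x \<in> S then 0 else b + x))"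
    if "finite S" "b \<le> M" for S b
  proof (rule strict_mono_onI)
    fix x y assume xy: "x \<in> entries P" "y \<in> entries P" "x < y"
    show "3 * M * rank S x + (if x \<in> S then 0 else b + x)
        < 3 * M * rank S y + (if y \<in> S then 0 else b + y)"
    proof (cases "rank S x = rank S y")
      case True
      then have "y \<notin> S" using rank_less[OF that(1) xy(3)] by auto
      then show ?thesis using True xy(3) by simp
    next
      case False
      then have "rank S x + 1 \<le> rank S y" using rank_mono[OF that(1), of x y] xy(3) by simp
      then have "3 * M * (rank S x + 1) \<le> 3 * M * rank S y" by (rule mult_le_mono2)
      moreover have "(if x \<in> S then 0 else b + x) < 3 * M" using ltM[OF xy(1)] that by auto
      ultimately show ?thesis unfolding distrib_left by linarith
    qed
  qed
  have fm: "strict_mono_on (entries P) f" using mono[OF fin(1), of 0] by (simp add: f_def cong: if_cong)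
  have gm: "strict_mono_on (entries P) g" using mono[OF fin(2), of M] by (simp add: g_def)
  \<comment> \<open>On border entries the offset vanishes and only the rank within the border
    remains; equality of the two reductions makes these ranks agree.\<close>
  have "map (map f) (drop (n - i) P) = map (map (\<lambda>x. 3 * M * rank C x)) (drop (n - i) P)"
    by (rule map_map_cong) (auto simp: f_def C_def)
  also have "\<dots> = map (map (\<lambda>x. 3 * M * x)) (red (drop (n - i) P))"
    unfolding red_eq_map_rank C_def by (simp add: comp_def)
  also have "\<dots> = map (map (\<lambda>x. 3 * M * x)) (red (take i P))"
    using assms(2) P(1) by (simp add: border_def)
  also have "\<dots> = map (map (\<lambda>x. 3 * M * rank D x)) (take i P)"
    unfolding red_eq_map_rank D_def by (simp add: comp_def)
  also have "\<dots> = map (map g) (take i P)"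
    by (rule map_map_cong) (auto simp: g_def D_def)
  finally have glue: "map (map f) (drop (n - i) P) = map (map g) (take i P)" .
  define F where "F = map (map f) P @ map (map g) (drop i P)"
  have takeF: "take n F = map (map f) P" using P(1) by (simp add: F_def)
  have "drop (n - i) F = map (map f) (drop (n - i) P) @ map (map g) (drop i P)"
    using P(1) by (simp add: F_def drop_map)
  also have "\<dots> = map (map g) P"
    unfolding glue by (metis append_take_drop_id map_append)
  finally have dropF: "drop (n - i) F = map (map g) P" .
  have sub: "entries (drop i P) \<subseteq> entries P" by (auto dest!: in_set_dropD)
  \<comment> \<open>Residues modulo \<open>3 * M\<close> separate the copies: \<open>g y\<close> has
    residue \<open>M + y\<close>, since \<open>y\<close> lies outside the glued columns, while
    residues of \<open>f\<close> stay below \<open>M\<close>.\<close>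
  have disj: "f x \<noteq> g y" if "x \<in> entries P" "y \<in> entries (drop i P)" for x y
  proof
    assume eq: "f x = g y"
    have "distinct (concat (take i P) @ concat (drop i P))"
      using P(2) by (simp add: column_strict_def flip: concat_append)
    then have "y \<notin> D" using that(2) unfolding D_def distinct_append by blast
    then have "g y mod (3 * M) = (M + y) mod (3 * M)" by (simp add: g_def)
    also have "\<dots> = M + y" using ltM(1)[OF subsetD[OF sub that(2)]] by (intro mod_less) linarith
    finally have "g y mod (3 * M) = M + y" .
    moreover have "f x mod (3 * M) < M"
      using ltM[OF that(1)] by (auto simp: f_def)
    ultimately show False using eq by simp
  qed
  have cf: "column_strict k (map (map f) P)" by (rule column_strict_map[OF P(2) fm])
  have cg: "column_strict k (map (map g) (drop i P))"
    by (rule column_strict_map[OF column_strict_drop[OF P(2)] monotone_on_subset[OF gm sub]])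
  have "f ` entries P \<inter> g ` entries (drop i P) = {}" using disj by blast
  then have "column_strict k F"
    using cf cg unfolding column_strict_def F_def concat_append distinct_append entries_map
    by auto
  moreover have "length F = 2 * n - i" using P(1) assms(3) by (simp add: F_def)
  ultimately have "red F \<in> arrays (2 * n - i) k" using red_in_arrays by metis
  moreover have "red (take n (red F)) = P"
    unfolding red_take_red takeF red_map[OF fm] by (rule red_arrays[OF assms(1)])
  moreover have "red (drop (n - i) (red F)) = P"
    unfolding red_drop_red dropF red_map[OF gm] by (rule red_arrays[OF assms(1)])
  ultimately show ?thesis by blast
qed

text \<open>Gluing along the longest proper border gives exactly two matches: a third one in between
  would overlap the first in more columns and so produce a longer border.\<close>

lemma longest_border_two_match_sizes:
  assumes "P \<in> arrays n k" "border P i" "1 \<le> i" "i < n"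
    and longest: "\<And>j. i < j \<Longrightarrow> j < n \<Longrightarrow> \<not> border P j"
  shows "2 * n - i \<in> two_match_sizes k P"
proof -
  obtain F where F: "F \<in> arrays (2 * n - i) k" "red (take n F) = P" "red (drop (n - i) F) = P"
    using ex_overlap[OF assms(1,2)] assms(4) by auto
  have len: "length P = n" "length F = 2 * n - i" using assms(1) F(1) by (auto simp: arrays_iff)
  have m1: "match_at P F 1" using F(2) len assms(4) by (simp add: match_at_iff)
  have m2: "match_at P F (n - i + 1)" using F(3) len assms(3,4) by (simp add: match_at_iff)
  have "p = 1 \<or> p = n - i + 1" if "match_at P F p" for p
  proof (rule ccontr)
    assume "\<not> ?thesis"
    moreover have "1 \<le> p" "p \<le> n - i + 1" using that len assms(4) by (auto simp: match_at_iff)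
    ultimately have p: "1 < p" "p < n - i + 1" by auto
    then have "border P (n - (p - 1))"
      using border_if_matches[OF m1 that] len by auto
    moreover have "i < n - (p - 1)" "n - (p - 1) < n" using p assms(4) by arith+
    ultimately show False using longest by blast
  qed
  with m1 m2 have "{p. match_at P F p} = {1, n - i + 1}" by auto
  then have "mch P F = 2" using assms(4) by (simp add: mch_def)
  then show ?thesis using F(1) assms(4) by (auto simp: two_match_sizes_def)
qed

text \<open>For \<open>n = 1\<close> the border condition is vacuous, yet an array with
  \<open>2 * n - 1 = 1\<close> column cannot contain two matches.\<close>

lemma minimally_overlapping_iff:
  assumes "2 \<le> n"
  shows "minimally_overlapping n k P \<longleftrightarrow>
     P \<in> arrays n k \<and> (\<forall>i. 2 \<le> i \<longrightarrow> i < n \<longrightarrow> \<not> border P i)"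
proof (intro iffI conjI)
  assume mo: "minimally_overlapping n k P"
  then show PA: "P \<in> arrays n k" by (simp add: minimally_overlapping_def)
  show "\<forall>i. 2 \<le> i \<longrightarrow> i < n \<longrightarrow> \<not> border P i"
  proof (rule ccontr)
    assume "\<not> ?thesis"
    then obtain i where "i \<in> {i. 2 \<le> i \<and> i < n \<and> border P i}" (is "_ \<in> ?B") by auto
    moreover have fin: "finite ?B" by (rule finite_subset[of _ "{..<n}"]) auto
    ultimately have m: "Max ?B \<in> ?B" by (intro Max_in) auto
    \<comment> \<open>The longest border, being at least 2, yields two matches in fewer than
      \<open>2 * n - 1\<close> columns.\<close>
    have "2 * n - Max ?B \<in> two_match_sizes k P"
    proof (rule longest_border_two_match_sizes[OF PA])
      show "\<not> border P j" if "Max ?B < j" "j < n" for j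
      proof
        assume "border P j"
        then have "j \<in> ?B" using that m by simp
        then show False using Max_ge[OF fin] that(1) leD by blast
      qed
    qed (use m in auto)
    then have "2 * n - 1 \<le> 2 * n - Max ?B" using mo by (auto simp: minimally_overlapping_def)
    then show False using m by auto
  qed
next
  assume H: "P \<in> arrays n k \<and> (\<forall>i. 2 \<le> i \<longrightarrow> i < n \<longrightarrow> \<not> border P i)"
  then have P: "P \<in> arrays n k" "length P = n" "column_strict k P" by (auto simp: arrays_iff)
  have "2 * n - 1 \<in> two_match_sizes k P"
    by (rule longest_border_two_match_sizes[OF P(1) border_1[OF P(3)]]) (use H P assms in auto)
  moreover have "2 * n - 1 \<le> i" if i: "i \<in> two_match_sizes k P" for i
  proof (rule ccontr)
    assume lt: "\<not> ?thesis"
    obtain F where F: "F \<in> arrays i k" "card {p. match_at P F p} = 2"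
      using i by (auto simp: two_match_sizes_def mch_def)
    obtain p q where m: "match_at P F p" "match_at P F q" "p < q"
    proof -
      obtain p q where "{p. match_at P F p} = {p, q}" "p \<noteq> q" using F(2) by (auto simp: card_2_iff)
      then show thesis
        using that[of p q] that[of q p] by (metis insertCI linorder_neqE_nat mem_Collect_eq)
    qed
    have "1 \<le> p" "q + n \<le> i + 1"
      using m F(1) P(2) by (auto simp: match_at_iff arrays_iff)
    \<comment> \<open>With fewer than \<open>2 * n - 1\<close> columns the two matches share at
      least two columns, hence give a border of size at least 2.\<close>
    then have "q - p < n - 1" using lt assms by linarith
    then have "border P (n - (q - p))" using border_if_matches[OF m] P(2) by auto
    then show False using H \<open>q - p < n - 1\<close> m(3) by auto
  qed
  ultimately show "minimally_overlapping n k P"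
    using P(1) by (simp add: minimally_overlapping_def)
qed

section \<open>Deleting a column\<close>

text \<open>Here \<open>p\<close> counts from 0, unlike the positions in
  \<open>match_at\<close>.\<close>

definition delete_column :: "nat \<Rightarrow> filling \<Rightarrow> filling" where
  "delete_column p F = take p F @ drop (Suc p) F"

lemma column_strict_delete_column:
  assumes "column_strict k F" "p < length F"
  shows "column_strict k (delete_column p F)" "length (delete_column p F) = length F - 1"
    "entries (delete_column p F) = entries F - set (F ! p)"
proof -
  have F: "F = take p F @ F ! p # drop (Suc p) F" using assms(2) by (rule id_take_nth_drop)
  have d: "distinct (concat (take p F) @ F ! p @ concat (drop (Suc p) F))"
    using assms(1) F by (metis column_strict_def concat.simps(2) concat_append)
  show "column_strict k (delete_column p F)"
    using assms(1) d unfolding column_strict_def delete_column_def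
    by (auto dest: in_set_takeD in_set_dropD)
  show "length (delete_column p F) = length F - 1"
    using assms(2) by (simp add: delete_column_def)
  have "entries F = entries (take p F) \<union> set (F ! p) \<union> entries (drop (Suc p) F)"
    by (subst F) (simp only: concat_append concat.simps set_append Un_assoc)
  then show "entries (delete_column p F) = entries F - set (F ! p)"
    using d unfolding delete_column_def concat_append set_append distinct_append by blast
qed

text \<open>The entry set of column \<open>p\<close> and the pattern of the other columns can be
  chosen independently, and together they determine the array: the set fixes which entries remain,
  the pattern how they are arranged.\<close>

lemma bij_betw_delete_column:
  assumes "p \<le> n"
  shows "bij_betw (\<lambda>F. (red (delete_column p F), set (F ! p))) (arrays (Suc n) k)
     (arrays n k \<times> {A. A \<subseteq> {1..k * Suc n} \<and> card A = k})"
    (is "bij_betw ?h ?X (?Y \<times> ?Z)")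
proof (intro bij_betw_imageI inj_onI set_eqI iffI)
  fix F G assume F: "F \<in> ?X" and G: "G \<in> ?X" and eq: "?h F = ?h G"
  have F': "length F = Suc n" "column_strict k F" "entries F = {1..k * Suc n}"
    using F by (auto simp only: arrays_iff)
  have G': "length G = Suc n" "column_strict k G" "entries G = {1..k * Suc n}"
    using G by (auto simp only: arrays_iff)
  have p: "p < length F" "p < length G" using assms F' G' by auto
  have col: "F ! p = G ! p"
    using eq F' G' p strict_sorted_equal[of "F ! p" "G ! p"] by (simp add: column_strict_def)
  let ?E = "entries (delete_column p F)"
  have E: "entries (delete_column p G) = ?E"
    using column_strict_delete_column(3)[OF F'(2) p(1)] column_strict_delete_column(3)[OF G'(2) p(2)]
      F'(3) G'(3) col by simp
  \<comment> \<open>Both arrays leave the same entries \<open>?E\<close>, on which ranks are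
    injective, so equal reductions mean equal remaining columns.\<close>
  have inj: "inj_on (rank ?E) ?E"
    by (intro strict_mono_on_imp_inj_on strict_mono_on_rank) simp
  have "inj_on (map (rank ?E)) (lists ?E)" using inj by (rule inj_on_map_lists)
  then have inj2: "inj_on (map (map (rank ?E))) (lists (lists ?E))" by (rule inj_on_map_lists)
  have "map (map (rank ?E)) (delete_column p F) = map (map (rank ?E)) (delete_column p G)"
    using eq E by (simp add: red_eq_map_rank)
  moreover have "delete_column p F \<in> lists (lists ?E)" by auto
  moreover have "delete_column p G \<in> lists (lists ?E)" unfolding E[symmetric] by auto
  ultimately have "delete_column p F = delete_column p G" using inj2 by (auto dest: inj_onD)
  then have "take p F = take p G" "drop (Suc p) F = drop (Suc p) G"
    using p by (auto simp: delete_column_def append_eq_append_conv)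
  then show "F = G" using col id_take_nth_drop[OF p(1)] id_take_nth_drop[OF p(2)] by simp
next
  fix z assume "z \<in> ?h ` ?X"
  then obtain F where F: "F \<in> ?X" and z: "z = ?h F" by auto
  have F': "length F = Suc n" "column_strict k F" "entries F = {1..k * Suc n}"
    using F by (auto simp only: arrays_iff)
  have p: "p < length F" using assms F' by simp
  have "red (delete_column p F) \<in> ?Y"
    using red_in_arrays[OF column_strict_delete_column(1)[OF F'(2) p]]
      column_strict_delete_column(2)[OF F'(2) p] F'(1) by simp
  moreover have "set (F ! p) \<subseteq> {1..k * Suc n}"
    using nth_mem[OF p] unfolding F'(3)[symmetric] by auto
  moreover have "card (set (F ! p)) = k"
    using F'(2) nth_mem[OF p] by (auto simp: column_strict_def strict_sorted_iff distinct_card)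
  ultimately show "z \<in> ?Y \<times> ?Z" using z by auto
next
  fix z assume "z \<in> ?Y \<times> ?Z"
  then obtain Q A where z: "z = (Q, A)" and Q: "Q \<in> ?Y" and A: "A \<subseteq> {1..k * Suc n}" "card A = k"
    by auto
  have Q': "length Q = n" "column_strict k Q" "entries Q = {1..k * n}"
    using Q by (auto simp only: arrays_iff)
  have finA: "finite A" using A(1) finite_subset by blast
  define B where "B = {1..k * Suc n} - A"
  have finB: "finite B" by (simp add: B_def)
  have cB: "card B = k * n" using A finA by (simp add: B_def card_Diff_subset)
  \<comment> \<open>\<open>h\<close> lists the entries left by \<open>A\<close> in increasing order,
    thereby undoing the reduction; \<open>j - 1\<close> appears because list indices start at
    0.\<close>
  define h where "h = (\<lambda>j. sorted_list_of_set B ! (j - 1))"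
  have h: "strict_mono_on {1..k * n} h"
    by (rule strict_mono_onI)
       (auto simp: h_def cB intro!: sorted_wrt_nth_less[OF strict_sorted_list_of_set])
  have hB: "h ` {1..k * n} = B"
  proof (rule card_subset_eq[OF finB])
    have "h j \<in> B" if "j \<in> {1..k * n}" for j
    proof -
      have "h j \<in> set (sorted_list_of_set B)"
        unfolding h_def by (rule nth_mem) (use that cB in auto)
      then show ?thesis using finB by simp
    qed
    then show "h ` {1..k * n} \<subseteq> B" by auto
    show "card (h ` {1..k * n}) = card B"
      using strict_mono_on_imp_inj_on[OF h] cB by (simp add: card_image)
  qed
  let ?R = "map (map h) Q"
  have hQ: "strict_mono_on (entries Q) h" unfolding Q'(3) by (rule h)
  have R: "column_strict k ?R" by (rule column_strict_map[OF Q'(2) hQ])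
  have eR: "entries ?R = B" unfolding entries_map Q'(3) by (rule hB)
  let ?c = "sorted_list_of_set A"
  define F where "F = take p ?R @ ?c # drop p ?R"
  have split: "entries (take p ?R) \<union> entries (drop p ?R) = B"
    unfolding eR[symmetric] by (metis append_take_drop_id concat_append set_append)
  have "distinct (concat (take p ?R) @ concat (drop p ?R))"
    using R unfolding column_strict_def concat_append[symmetric] append_take_drop_id by simp
  moreover have "A \<inter> B = {}" by (auto simp: B_def)
  moreover have "set ?c = A" "distinct ?c" using finA by auto
  ultimately have "distinct (concat F)"
    using split unfolding F_def concat_append concat.simps distinct_append set_append by blast
  moreover have "\<forall>c\<in>set F. length c = k \<and> sorted_wrt (<) c"
  proof
    fix c assume "c \<in> set F"
    then consider "c = ?c" | "c \<in> set ?R"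
      unfolding F_def by (auto dest: in_set_takeD in_set_dropD simp del: set_map)
    then show "length c = k \<and> sorted_wrt (<) c"
      using R A(2) unfolding column_strict_def by cases auto
  qed
  ultimately have "column_strict k F" by (simp add: column_strict_def)
  moreover have "length F = Suc n" using Q'(1) assms by (simp add: F_def)
  moreover have "entries F = A \<union> B"
    using split \<open>set ?c = A\<close> unfolding F_def concat_append concat.simps set_append by blast
  moreover have "A \<union> B = {1..k * Suc n}" using A(1) by (auto simp: B_def)
  ultimately have FX: "F \<in> ?X" by (simp only: arrays_iff)
  have lt: "length (take p ?R) = p" using Q'(1) assms by simp
  have "delete_column p F = ?R" using lt unfolding delete_column_def F_def by simp
  then have "red (delete_column p F) = Q" using red_map[OF hQ] red_arrays[OF Q] by simp
  moreover have "F ! p = ?c" using lt unfolding F_def by (metis nth_append_length)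
  ultimately have "z = ?h F" using z finA by simp
  then show "z \<in> ?h ` ?X" using FX by blast
qed

lemma red_delete_column_in_arrays:
  "p \<le> n \<Longrightarrow> F \<in> arrays (Suc n) k \<Longrightarrow> red (delete_column p F) \<in> arrays n k"
  using bij_betw_apply[OF bij_betw_delete_column[of p n k], of F] by blast

text \<open>All fibres of column deletion have the same size, the number of possible entry sets of
  the deleted column. Pulling \<open>S\<close> back therefore preserves its proportion.\<close>

lemma card_delete_column_preimage:
  assumes "p \<le> n" "S \<subseteq> arrays n k"
  shows "card {F \<in> arrays (Suc n) k. red (delete_column p F) \<in> S} = card S * (k * Suc n choose k)"
proof -
  let ?h = "\<lambda>F. (red (delete_column p F), set (F ! p))"
  let ?Z = "{A. A \<subseteq> {1..k * Suc n} \<and> card A = k}"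
  note bij = bij_betw_delete_column[OF assms(1), of k]
  let ?X = "{F \<in> arrays (Suc n) k. red (delete_column p F) \<in> S}"
  have "?h ` ?X = ?h ` arrays (Suc n) k \<inter> S \<times> UNIV" by (rule set_eqI) (simp add: image_iff, fast)
  also have "\<dots> = (arrays n k \<times> ?Z) \<inter> S \<times> UNIV" unfolding bij_betw_imp_surj_on[OF bij] ..
  also have "\<dots> = S \<times> ?Z" using assms(2) by auto
  finally have image: "?h ` ?X = S \<times> ?Z" .
  have "inj_on ?h ?X"
    by (rule inj_on_subset[OF bij_betw_imp_inj_on[OF bij]]) simp
  from card_image[OF this] have "card ?X = card (S \<times> ?Z)" unfolding image ..
  also have "\<dots> = card S * card ?Z" by (rule card_cartesian_product)
  also have "card ?Z = k * Suc n choose k" using n_subsets[of "{1..k * Suc n}" k] by simp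
  finally show ?thesis .
qed

lemma card_arrays_Suc: "card (arrays (Suc n) k) = card (arrays n k) * (k * Suc n choose k)"
proof -
  have "{F \<in> arrays (Suc n) k. red (delete_column 0 F) \<in> arrays n k} = arrays (Suc n) k"
    using red_delete_column_in_arrays[of 0 n] by blast
  then show ?thesis using card_delete_column_preimage[of 0 n "arrays n k" k] by simp
qed

lemma card_arrays_pos: "0 < card (arrays n k)"
proof (induction n)
  case 0
  have "arrays 0 k = {[]}" by (auto simp: arrays_def)
  then show ?case by simp
next
  case (Suc n)
  then show ?case by (simp add: card_arrays_Suc)
qed

section \<open>Arrays without short borders\<close>

text \<open>The bound \<open>2 * i \<le> n\<close> makes the first and last \<open>i\<close> columns
  disjoint. It falls short of the bound in \<open>ex_short_border\<close> by one, which leaves out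
  \<open>2 * i = n + 1\<close>.\<close>

definition no_short_border :: "nat \<Rightarrow> nat \<Rightarrow> filling set" where
  "no_short_border n k = {P \<in> arrays n k. \<forall>i. 2 \<le> i \<longrightarrow> 2 * i \<le> n \<longrightarrow> \<not> border P i}"

text \<open>Counted from 0, column \<open>n div 2\<close> of the \<open>n + 1\<close> columns lies
  after the first \<open>i\<close> and before the last \<open>i\<close>.\<close>

lemma border_delete_middle:
  assumes "length P = Suc n" "2 * i \<le> n"
  shows "border (red (delete_column (n div 2) P)) i \<longleftrightarrow> border P i"
proof -
  let ?p = "n div 2"
  let ?D = "delete_column ?p P"
  have len: "length ?D = n" using assms(1) by (simp add: delete_column_def)
  have "i \<le> ?p" using assms(2) by simp
  then have "take i ?D = take i P" using assms(1) by (simp add: delete_column_def min_absorb1)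
  moreover have "drop (n - i) ?D = drop (Suc n - i) P"
    using assms by (auto simp: delete_column_def min_def Suc_diff_le)
  ultimately show ?thesis
    using assms(1) len by (simp add: border_def red_take_red red_drop_red)
qed

lemma decseq_no_short_border:
  "decseq (\<lambda>n. real (card (no_short_border n k)) / real (card (arrays n k)))"
proof (rule decseq_SucI)
  fix n
  let ?C = "k * Suc n choose k"
  have "no_short_border (Suc n) k \<subseteq>
      {P \<in> arrays (Suc n) k. red (delete_column (n div 2) P) \<in> no_short_border n k}"
  proof
    fix P assume P: "P \<in> no_short_border (Suc n) k"
    then have PA: "P \<in> arrays (Suc n) k" "length P = Suc n"
      by (auto simp: no_short_border_def arrays_iff)
    then have "red (delete_column (n div 2) P) \<in> arrays n k"
      by (intro red_delete_column_in_arrays) simp_all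
    moreover have "\<not> border P i" if "2 \<le> i" "2 * i \<le> n" for i
      using P that by (auto simp: no_short_border_def)
    ultimately show "P \<in> {P \<in> arrays (Suc n) k. red (delete_column (n div 2) P) \<in> no_short_border n k}"
      using PA border_delete_middle[OF PA(2)] by (auto simp: no_short_border_def)
  qed
  then have "card (no_short_border (Suc n) k) \<le>
      card {P \<in> arrays (Suc n) k. red (delete_column (n div 2) P) \<in> no_short_border n k}"
    by (rule card_mono[rotated]) (simp add: finite_arrays)
  also have "\<dots> = card (no_short_border n k) * ?C"
    by (rule card_delete_column_preimage) (auto simp: no_short_border_def)
  finally have "real (card (no_short_border (Suc n) k)) \<le> real (card (no_short_border n k)) * real ?C"
    by (metis of_nat_le_iff of_nat_mult)
  moreover have "0 < ?C" by simp
  ultimately show "real (card (no_short_border (Suc n) k)) / real (card (arrays (Suc n) k))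
      \<le> real (card (no_short_border n k)) / real (card (arrays n k))"
    using card_arrays_pos[of n k] unfolding card_arrays_Suc
    by (simp add: divide_simps del: mult_Suc_right binomial_Suc_Suc)
qed

section \<open>The remaining border size and the limit\<close>

text \<open>Rotating the columns \<open>m + 1, \<dots>, 2 m\<close> in the \<open>m\<close> possible ways gives \<open>m\<close> arrays, at most one of
  which has the same pattern there as in the first \<open>m\<close> columns.\<close>

lemma card_equal_patterns_le:
  assumes "1 \<le> k"
  shows "m * card {P \<in> arrays (2 * m + 1) k. red (take m P) = red (take m (drop m P))}
    \<le> card (arrays (2 * m + 1) k)"
proof -
  let ?X = "{P \<in> arrays (2 * m + 1) k. red (take m P) = red (take m (drop m P))}"
  define \<phi> where "\<phi> = (\<lambda>(P :: filling, t). take m P @ rotate t (take m (drop m P)) @ drop (2 * m) P)"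
  have parts: "take m (\<phi> (P, t)) = take m P" "take m (drop m (\<phi> (P, t))) = rotate t (take m (drop m P))"
      "drop (2 * m) (\<phi> (P, t)) = drop (2 * m) P"
    if "P \<in> arrays (2 * m + 1) k" for P t
    using that by (auto simp: \<phi>_def arrays_iff)
  have decomp: "take m P @ take m (drop m P) @ drop (2 * m) P = P" for P :: filling
  proof -
    have "drop (2 * m) P = drop m (drop m P)" by (simp add: mult_2)
    then show ?thesis by (simp only: append_take_drop_id)
  qed
  have red_rotate: "red (rotate t F) = rotate t (red F)" for t F
    by (simp add: red_eq_map_rank rotate_map)
  have inj: "inj_on \<phi> (?X \<times> {..<m})"
  proof (rule inj_onI, clarify)
    fix P s Q t
    assume P: "P \<in> arrays (2 * m + 1) k" and Q: "Q \<in> arrays (2 * m + 1) k"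
      and bP: "red (take m P) = red (take m (drop m P))"
      and bQ: "red (take m Q) = red (take m (drop m Q))"
      and st: "s < m" "t < m" and eq: "\<phi> (P, s) = \<phi> (Q, t)"
    have e1: "take m P = take m Q" using parts(1)[OF P, of s] parts(1)[OF Q, of t] eq by simp
    have e2: "rotate s (take m (drop m P)) = rotate t (take m (drop m Q))"
      using parts(2)[OF P, of s] parts(2)[OF Q, of t] eq by simp
    have e3: "drop (2 * m) P = drop (2 * m) Q" using parts(3)[OF P, of s] parts(3)[OF Q, of t] eq by simp
    define W where "W = red (take m P)"
    \<comment> \<open>Reduction commutes with rotation, and both middle windows reduce to the
      pattern \<open>W\<close> of the common first \<open>m\<close> columns.\<close>
    have rot: "rotate s W = rotate t W"
      using arg_cong[OF e2, of red] unfolding red_rotate bP[symmetric] bQ[symmetric] e1 W_def .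
    have P': "length P = 2 * m + 1" "column_strict k P" using P by (auto simp: arrays_iff)
    have lW: "length W = m" using P' by (simp add: W_def)
    have "W \<in> arrays m k"
      using red_in_arrays[OF column_strict_take[OF P'(2), of m]] P' by (simp add: W_def)
    then have "column_strict k W" by (simp add: arrays_iff)
    \<comment> \<open>Disjointness of the columns makes them distinct only when they are nonempty,
      which is where \<open>1 \<le> k\<close> enters. The first column of a rotation of
      \<open>W\<close> then reveals the amount of rotation.\<close>
    then have d: "distinct (concat W)" "[] \<notin> set W" using assms by (auto simp only: column_strict_def list.size)
    have "distinct W" using d(1) unfolding distinct_concat_iff removeAll_id[OF d(2)] by (rule conjunct1)
    moreover have "W ! s = W ! t"
    proof -
      have "W \<noteq> []" using st lW by auto
      then have "hd (rotate s W) = W ! s" "hd (rotate t W) = W ! t"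
        using st lW by (simp_all add: hd_rotate_conv_nth)
      then show ?thesis using rot by metis
    qed
    ultimately have "s = t" using st lW by (simp add: nth_eq_iff_index_eq)
    moreover have "inj (rotate s :: filling \<Rightarrow> filling)"
      unfolding rotate_def by (rule inj_fn[OF inj_rotate1])
    ultimately have "take m (drop m P) = take m (drop m Q)" using e2 by (auto dest: injD)
    then have "P = Q" using decomp[of P] unfolding e1 e3 decomp by (simp only: decomp)
    then show "P = Q \<and> s = t" using \<open>s = t\<close> ..
  qed
  have "\<phi> (P, t) \<in> arrays (2 * m + 1) k" if P: "P \<in> arrays (2 * m + 1) k" for P t
  proof -
    obtain X Y where XY: "take m (drop m P) = X @ Y" "rotate t (take m (drop m P)) = Y @ X"
      by (metis rotate_drop_take append_take_drop_id)
    have "P = take m P @ X @ Y @ drop (2 * m) P"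
      using decomp[of P] XY(1) by simp
    moreover have "\<phi> (P, t) = take m P @ Y @ X @ drop (2 * m) P"
      using XY(2) by (simp add: \<phi>_def)
    \<comment> \<open>A rotation only permutes columns, and the conditions of \<open>arrays\<close>
      do not depend on their order.\<close>
    moreover have "A @ Y @ X @ C \<in> arrays (2 * m + 1) k"
      if "A @ X @ Y @ C \<in> arrays (2 * m + 1) k" for A C
      using that unfolding arrays_def by (auto simp: Un_ac)
    ultimately show ?thesis using P by (simp only:)
  qed
  then have "\<phi> ` (?X \<times> {..<m}) \<subseteq> arrays (2 * m + 1) k" by auto
  then have "card (?X \<times> {..<m}) \<le> card (arrays (2 * m + 1) k)"
    by (rule card_inj_on_le[OF inj _ finite_arrays])
  then show ?thesis by (simp add: card_cartesian_product mult.commute)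
qed

lemma unbordered_difference:
  assumes "1 \<le> k" "2 \<le> n"
  shows "num_minimally_overlapping n k \<le> card (no_short_border n k)"
    and "(n div 2) * (card (no_short_border n k) - num_minimally_overlapping n k) \<le> card (arrays n k)"
proof -
  let ?U = "{P. minimally_overlapping n k P}"
  let ?E = "no_short_border n k"
  let ?m = "n div 2"
  have U: "P \<in> ?U \<longleftrightarrow> P \<in> arrays n k \<and> (\<forall>i. 2 \<le> i \<longrightarrow> i < n \<longrightarrow> \<not> border P i)" for P
    using minimally_overlapping_iff[OF assms(2)] by simp
  have sub: "?U \<subseteq> ?E" using U by (auto simp: no_short_border_def)
  have finE: "finite ?E" by (simp add: no_short_border_def finite_arrays)
  show "num_minimally_overlapping n k \<le> card ?E"
    unfolding num_minimally_overlapping_def by (rule card_mono[OF finE sub])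
  have diff: "card ?E - num_minimally_overlapping n k = card (?E - ?U)"
    unfolding num_minimally_overlapping_def
    by (rule card_Diff_subset[symmetric]) (use sub finE finite_subset in auto)
  have key: "n = 2 * ?m + 1 \<and> red (take ?m P) = red (take ?m (drop ?m P))"
    if P: "P \<in> ?E - ?U" for P
  proof -
    have PA: "P \<in> arrays n k" "length P = n" using P by (auto simp: no_short_border_def arrays_iff)
    obtain j where j: "2 \<le> j" "2 * j \<le> n + 1" "border P j"
      using P U[of P] PA ex_short_border[of P] by auto
    have "\<not> 2 * j \<le> n" using P j by (auto simp: no_short_border_def)
    then have n: "n = 2 * ?m + 1" "j = Suc ?m" using j(2) by presburger+
    have "n - j = ?m" using n by presburger
    then have b: "red (take j P) = red (drop ?m P)" using j(3) PA(2) by (simp add: border_def)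
    \<comment> \<open>The first and last \<open>?m + 1\<close> columns share the middle one. Keeping
      the first \<open>?m\<close> columns of each window gives the disjoint windows of
      \<open>card_equal_patterns_le\<close>.\<close>
    have "red (take ?m P) = red (take ?m (drop ?m P))"
      using red_take_drop_cong[OF b, of ?m 0] n(2) by (simp add: min_absorb1)
    with n(1) show ?thesis ..
  qed
  show "?m * (card ?E - num_minimally_overlapping n k) \<le> card (arrays n k)"
  proof (cases "?E - ?U = {}")
    case True
    have "card ?E - num_minimally_overlapping n k = 0" unfolding diff True by (rule card.empty)
    then show ?thesis by simp
  next
    case False
    then have n: "n = 2 * ?m + 1" using key by blast
    have "?E - ?U \<subseteq> {P \<in> arrays n k. red (take ?m P) = red (take ?m (drop ?m P))}"
      using key by (auto simp: no_short_border_def)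
    then have "card (?E - ?U) \<le> card {P \<in> arrays n k. red (take ?m P) = red (take ?m (drop ?m P))}"
      by (rule card_mono[rotated]) (simp add: finite_arrays)
    then have "?m * card (?E - ?U)
        \<le> ?m * card {P \<in> arrays n k. red (take ?m P) = red (take ?m (drop ?m P))}"
      by (rule mult_le_mono2)
    also have "\<dots> \<le> card (arrays n k)"
      using card_equal_patterns_le[OF assms(1), of ?m] unfolding n[symmetric] .
    finally show ?thesis unfolding diff .
  qed
qed

theorem theorem9:
  fixes k :: nat
  assumes "1 \<le> k"
  shows "convergent (\<lambda>n. proportion n k)"
proof -
  define e where "e = (\<lambda>n. real (card (no_short_border n k)) / real (card (arrays n k)))"
  have "decseq e" unfolding e_def by (rule decseq_no_short_border)
  \<comment> \<open>The decreasing sequence \<open>e\<close> is bounded below by 0.\<close>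
  then obtain L where L: "e \<longlonglongrightarrow> L"
    using decseq_convergent[of e 0] by (auto simp: e_def)
  have bound: "0 \<le> e n - proportion n k \<and> e n - proportion n k \<le> 1 / real (n div 2)"
    if "2 \<le> n" for n
  proof -
    note u = unbordered_difference[OF assms that]
    let ?d = "card (no_short_border n k) - num_minimally_overlapping n k"
    have eq: "e n - proportion n k = real ?d / real (card (arrays n k))"
      using u(1) by (simp add: e_def proportion_def of_nat_diff diff_divide_distrib)
    have "real (n div 2) * real ?d \<le> real (card (arrays n k))"
      using u(2) by (metis of_nat_le_iff of_nat_mult)
    moreover have "0 < real (n div 2)" "0 < real (card (arrays n k))"
      using that card_arrays_pos[of n k] by auto
    ultimately have "real ?d / real (card (arrays n k)) \<le> 1 / real (n div 2)"
      by (simp add: divide_simps mult.commute)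
    then show ?thesis unfolding eq by simp
  qed
  have "filterlim (\<lambda>n::nat. n div 2) at_top sequentially"
    unfolding filterlim_at_top
  proof
    fix Z show "\<forall>\<^sub>F n in sequentially. Z \<le> n div 2"
      by (rule eventually_sequentiallyI[of "2 * Z"]) simp
  qed
  then have lim: "(\<lambda>n. 1 / real (n div 2)) \<longlonglongrightarrow> 0"
    using filterlim_compose[OF lim_1_over_n] by blast
  \<comment> \<open>The proportion differs from \<open>e\<close> by a term squeezed to 0, so both
    have the limit \<open>L\<close>.\<close>
  have "(\<lambda>n. e n - proportion n k) \<longlonglongrightarrow> 0"
  proof (rule tendsto_sandwich[OF _ _ tendsto_const lim])
    show "\<forall>\<^sub>F n in sequentially. 0 \<le> e n - proportion n k"
      by (rule eventually_sequentiallyI[of 2]) (use bound in blast)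
    show "\<forall>\<^sub>F n in sequentially. e n - proportion n k \<le> 1 / real (n div 2)"
      by (rule eventually_sequentiallyI[of 2]) (use bound in blast)
  qed
  from tendsto_diff[OF L this] show ?thesis by (auto simp: convergent_def)
qed

end
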